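(* Let $(\alpha,\beta)$ be an admissible non-null pair. Then: (1) the tiling $\mathcal{T}_{(\alpha,\beta)}$ is self-replicating; (2) if $\alpha$ and $\beta$ are eventually periodic, then only finitely many distinct lengths occur among the tiles of $\mathcal{T}_{(\alpha,\beta)}$.
   Context: Let $\Omega=\{0,1\}^{\infty}$ be the set of infinite strings $\omega=\omega_0\omega_1\omega_2\cdots$ with $\omega_n\in\{0,1\}$. The shift $S:\Omega\to\Omega$ is $S(\omega_0\omega_1\omega_2\cdots)=\omega_1\omega_2\cdots$, $S^n$ its $n$-th iterate. Lexicographic order on $\Omega$: $\sigma\prec\omega$ if $\sigma\neq\omega$ and $\sigma_k<\omega_k$ at the least index $k$ with $\sigma_k\neq\omega_k$; intervals $[\alpha,\beta]=\{\omega:\alpha\preceq\omega\preceq\beta\}$, and similarly $(\alpha,\beta]$, $[\alpha,\beta)$. A string $\omega$ is eventually periodic if $S^m\omega=\overline{s}=sss\cdots$ for some $m\ge0$ and finite string $s$. Decimals: $\Omega^{\bullet}$ is the set of decimals $\omega_0\cdots\omega_N\bullet\omega_{N+1}\cdots$ obtained from an element of $\Omega$ by inserting a decimal point, where initial zeros before the point are omitted. For $\Gamma\subseteq\Omega$, $\Gamma^{\bullet}$ is the set of all decimals obtained from strings of $\Gamma$ by placing the point anywhere. For $\omega\in\Omega^{\bullet}$, $\omega\bullet$ denotes the finite substring of $\omega$ to the left of the decimal point. A pair $(\alpha,\beta)$ in $\Omega$ is admissible if $\alpha_0=0,\alpha_1=1,\beta_0=1,\beta_1=0$, and $S^n\alpha\notin(\alpha,\beta]$,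 $S^n\beta\notin[\alpha,\beta)$ for all $n\ge0$. Define $\Omega_{(\alpha,\beta,-)}=\{\omega: S^n\omega\notin(\alpha,\beta]\ \forall n\ge0\}$, $\Omega_{(\alpha,\beta,+)}=\{\omega: S^n\omega\notin[\alpha,\beta)\ \forall n\ge0\}$, $\Omega_{(\alpha,\beta)}=\Omega_{(\alpha,\beta,-)}\cup\Omega_{(\alpha,\beta,+)}$, $\Omega^0_{(\alpha,\beta,-)}=\{\omega\in\Omega_{(\alpha,\beta,-)}:0\omega\preceq\alpha\}$, and $\Omega^{\bullet}_{(\alpha,\beta,-)}=[\Omega^0_{(\alpha,\beta,-)}]^{\bullet}$. For $\Gamma\subseteq\Omega$ let $\Gamma_n=\{\gamma_0\cdots\gamma_{n-1}:\gamma\in\Gamma\}$ and $h(\Gamma)=\limsup_n\frac1n\ln|\Gamma_n|$; the pair is non-null if $h(\Omega_{(\alpha,\beta)})>0$. For an admissible non-null pair let $b$ be the minimum solution in $[\tfrac12,1)$ of $\sum_{n\ge0}\alpha_nx^n=\sum_{n\ge0}\beta_nx^n$, $B=1/b$, and $\pi(\omega_0\cdots\omega_N\bullet\omega_{N+1}\cdots)=\sum_{n=-\infty}^{N}\omega_{N-n}B^n$ on $\Gamma:=\Omega^{\bullet}_{(\alpha,\beta,-)}$; $\pi:\Gamma\to[0,\infty)$ is a strictly increasing bijection. Tiling: for a finite binary string $s$ let $T'_s=\{\pi(\omega):\omega\in\Gamma,\ \omega\bullet=s\}$; when $T'_s\neq\emptyset$ its closure $T_s$ is a closed interval, called a tile.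 $\mathcal{T}_{(\alpha,\beta)}$ is the collection of all tiles $T_s$ (a collection of non-overlapping intervals with union $[0,\infty)$). The tiling is self-replicating if each interval $BT=\{Bx:x\in T\}$, $T\in\mathcal{T}_{(\alpha,\beta)}$, is a union of tiles of $\mathcal{T}_{(\alpha,\beta)}$. *)

theory Defs
  imports "HOL-Analysis.Analysis" "HOL-Library.Stream"
begin

text \<open>
  Infinite binary strings are elements of \<^typ>\<open>bool stream\<close>, with \<^term>\<open>False\<close> for the digit 0 and
  \<^term>\<open>True\<close> for the digit 1; the \<open>n\<close>-th iterate of the shift is \<^term>\<open>sdrop n\<close>, and the periodic
  string \<open>sss\<dots>\<close> is \<^term>\<open>cycle s\<close> (for \<open>s \<noteq> []\<close>).
\<close>

definition lex_less :: "bool stream \<Rightarrow> bool stream \<Rightarrow> bool" where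
  "lex_less \<sigma> \<omega> \<longleftrightarrow> (\<exists>k. (\<forall>j<k. \<sigma> !! j = \<omega> !! j) \<and> \<sigma> !! k < \<omega> !! k)"

definition lex_le :: "bool stream \<Rightarrow> bool stream \<Rightarrow> bool" where
  "lex_le \<sigma> \<omega> \<longleftrightarrow> lex_less \<sigma> \<omega> \<or> \<sigma> = \<omega>"

definition lex_Ioc :: "bool stream \<Rightarrow> bool stream \<Rightarrow> bool stream set" where
  "lex_Ioc \<alpha> \<beta> = {\<omega>. lex_less \<alpha> \<omega> \<and> lex_le \<omega> \<beta>}"

definition lex_Ico :: "bool stream \<Rightarrow> bool stream \<Rightarrow> bool stream set" where
  "lex_Ico \<alpha> \<beta> = {\<omega>. lex_le \<alpha> \<omega> \<and> lex_less \<omega> \<beta>}"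

definition eventually_periodic :: "bool stream \<Rightarrow> bool" where
  "eventually_periodic \<omega> \<longleftrightarrow> (\<exists>m s. s \<noteq> [] \<and> sdrop m \<omega> = cycle s)"

definition admissible :: "bool stream \<Rightarrow> bool stream \<Rightarrow> bool" where
  "admissible \<alpha> \<beta> \<longleftrightarrow>
     \<alpha> !! 0 = False \<and> \<alpha> !! 1 = True \<and> \<beta> !! 0 = True \<and> \<beta> !! 1 = False \<and>
     (\<forall>n. sdrop n \<alpha> \<notin> lex_Ioc \<alpha> \<beta>) \<and> (\<forall>n. sdrop n \<beta> \<notin> lex_Ico \<alpha> \<beta>)"

definition Omega_minus :: "bool stream \<Rightarrow> bool stream \<Rightarrow> bool stream set" where
  "Omega_minus \<alpha> \<beta> = {\<omega>. \<forall>n. sdrop n \<omega> \<notin> lex_Ioc \<alpha> \<beta>}"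

definition Omega_plus :: "bool stream \<Rightarrow> bool stream \<Rightarrow> bool stream set" where
  "Omega_plus \<alpha> \<beta> = {\<omega>. \<forall>n. sdrop n \<omega> \<notin> lex_Ico \<alpha> \<beta>}"

definition Omega_pair :: "bool stream \<Rightarrow> bool stream \<Rightarrow> bool stream set" where
  "Omega_pair \<alpha> \<beta> = Omega_minus \<alpha> \<beta> \<union> Omega_plus \<alpha> \<beta>"

definition Omega0_minus :: "bool stream \<Rightarrow> bool stream \<Rightarrow> bool stream set" where
  "Omega0_minus \<alpha> \<beta> = {\<omega> \<in> Omega_minus \<alpha> \<beta>. lex_le (False ## \<omega>) \<alpha>}"

definition entropy :: "bool stream set \<Rightarrow> ereal" where
  "entropy \<Gamma> = limsup (\<lambda>n. ereal (ln (real (card (stake n ` \<Gamma>))) / real n))"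

definition non_null :: "bool stream \<Rightarrow> bool stream \<Rightarrow> bool" where
  "non_null \<alpha> \<beta> \<longleftrightarrow> entropy (Omega_pair \<alpha> \<beta>) > 0"

text \<open>
  A decimal is a pair \<open>(s, \<tau>)\<close>: \<open>s\<close> is the finite string to the left of the point, without
  initial zeros (so possibly empty), and \<open>\<tau>\<close> is the infinite string to the right of it.
\<close>

type_synonym decimal = "bool list \<times> bool stream"

definition insert_point :: "nat \<Rightarrow> bool stream \<Rightarrow> decimal" where
  "insert_point k \<omega> = (dropWhile Not (stake k \<omega>), sdrop k \<omega>)"

definition decimals_of :: "bool stream set \<Rightarrow> decimal set" where
  "decimals_of \<Gamma> = {insert_point k \<omega> | k \<omega>. \<omega> \<in> \<Gamma>}"

definition left_part :: "decimal \<Rightarrow> bool list" where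
  "left_part d = fst d"

definition base_inv :: "bool stream \<Rightarrow> bool stream \<Rightarrow> real" where
  "base_inv \<alpha> \<beta> = (LEAST x. x \<in> {1/2..<1} \<and>
     (\<Sum>n. of_bool (\<alpha> !! n) * x ^ n) = (\<Sum>n. of_bool (\<beta> !! n) * x ^ n))"

definition base :: "bool stream \<Rightarrow> bool stream \<Rightarrow> real" where
  "base \<alpha> \<beta> = 1 / base_inv \<alpha> \<beta>"

text \<open>
  Value of a decimal in base \<open>B\<close>: the digit at position \<open>i\<close> of the left part has weight
  \<open>B\<^bsup>N-i\<^esup>\<close> with \<open>N = length s - 1\<close>, and the digit at position \<open>j\<close> of the right part has
  weight \<open>B\<^bsup>-(j+1)\<^esup>\<close>.
\<close>

definition decimal_value :: "real \<Rightarrow> decimal \<Rightarrow> real" where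
  "decimal_value B d = (case d of (s, \<tau>) \<Rightarrow>
     (\<Sum>i<length s. of_bool (s ! i) * B ^ (length s - 1 - i)) +
     (\<Sum>j. of_bool (\<tau> !! j) / B ^ (j + 1)))"

definition pretile :: "bool stream \<Rightarrow> bool stream \<Rightarrow> bool list \<Rightarrow> real set" where
  "pretile \<alpha> \<beta> s =
     {decimal_value (base \<alpha> \<beta>) d | d. d \<in> decimals_of (Omega0_minus \<alpha> \<beta>) \<and> left_part d = s}"

definition tile :: "bool stream \<Rightarrow> bool stream \<Rightarrow> bool list \<Rightarrow> real set" where
  "tile \<alpha> \<beta> s = closure (pretile \<alpha> \<beta> s)"

definition tiling :: "bool stream \<Rightarrow> bool stream \<Rightarrow> real set set" where
  "tiling \<alpha> \<beta> = {tile \<alpha> \<beta> s | s. pretile \<alpha> \<beta> s \<noteq> {}}"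

definition self_replicating :: "real \<Rightarrow> real set set \<Rightarrow> bool" where
  "self_replicating B \<T> \<longleftrightarrow> (\<forall>T\<in>\<T>. \<exists>C\<subseteq>\<T>. (\<lambda>x. B * x) ` T = \<Union>C)"

text \<open>Intended for compact intervals, for which it is the distance between the endpoints.\<close>

definition interval_length :: "real set \<Rightarrow> real" where
  "interval_length T = Sup T - Inf T"

end

theory Submission
  imports Defs "HOL-Library.List_Lexorder"
begin

text \<open>
  The base is defined as a least element, so one must first show that the equation for \<open>b\<close> has a
  solution. Let \<open>N\<^sub>n\<close> count the words of length \<open>n\<close> of the strings no shift of which lies in the open
  interval \<open>(\<alpha>, \<beta>)\<close>. Counting the words below a given string \<open>\<omega>\<close> gives a recursion along the orbit
  of \<open>\<omega>\<close>; comparing its solutions for \<open>\<alpha>\<close>, \<open>\<beta>\<close> and \<open>111\<dots>\<close> shows that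
  \<open>(\<Sum> (\<beta>\<^sub>n - \<alpha>\<^sub>n) x\<^sup>n) (\<Sum> (N\<^sub>n - 1) x\<^sup>n) = \<Sum> n x\<^sup>n\<close>. Since \<open>N\<close> is submultiplicative and grows
  exponentially, the second factor tends to infinity at its radius of convergence \<open>R < 1\<close>, so the
  first one is not positive at \<open>R\<close>, while it is nonnegative at \<open>1/2\<close>.

  Multiplication by \<open>B\<close> moves the point by one digit, so it maps the tile of \<open>s\<close> to the union of
  the tiles of \<open>s0\<close> and \<open>s1\<close>. The length of the tile of \<open>s\<close> depends only on the set of tails that
  may follow \<open>s\<close>. Whether \<open>\<tau>\<close> may follow is decided by comparing \<open>\<tau>\<close> with the shifts of \<open>\<alpha>\<close> and \<open>\<beta>\<close>,
  of which there are finitely many in the eventually periodic case.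
\<close>

section \<open>Lexicographic order\<close>

text \<open>Prefixes of equal length are compared at their first differing digit, so the rule of the
  list order for proper prefixes never applies. The linear order on lists thus becomes available for
  infinite strings.\<close>

lemma stake_less_iff:
  "stake n \<sigma> < stake n \<omega> \<longleftrightarrow> (\<exists>k<n. (\<forall>j<k. \<sigma> !! j = \<omega> !! j) \<and> \<sigma> !! k < \<omega> !! k)"
proof (induction n arbitrary: \<sigma> \<omega>)
  case (Suc n)
  show ?case
    by (simp add: Suc.IH Ex_less_Suc2 All_less_Suc2 conj_assoc)
      (metis)
qed simp

lemma lex_less_iff: "lex_less \<sigma> \<omega> \<longleftrightarrow> (\<exists>n. stake n \<sigma> < stake n \<omega>)"
  unfolding lex_less_def stake_less_iff by blast

lemma not_lex_less_iff: "\<not> lex_less \<sigma> \<omega> \<longleftrightarrow> (\<forall>n. stake n \<omega> \<le> stake n \<sigma>)"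
  by (simp add: lex_less_iff not_less)

text \<open>Two distinct strings differ in some prefix, and prefixes are linearly ordered; so the
  order on infinite strings is total as well.\<close>

lemma not_lex_less: "\<not> lex_less \<sigma> \<omega> \<longleftrightarrow> lex_le \<omega> \<sigma>"
proof
  assume h: "\<not> lex_less \<sigma> \<omega>"
  show "lex_le \<omega> \<sigma>"
  proof (cases "\<omega> = \<sigma>")
    case False
    then obtain n where "\<omega> !! n \<noteq> \<sigma> !! n"
      using smap_alt[of id \<omega> \<sigma>] by (auto simp: stream.map_id)
    then have "stake (Suc n) \<omega> \<noteq> stake (Suc n) \<sigma>"
      by (metis lessI stake_nth)
    with h have "stake (Suc n) \<omega> < stake (Suc n) \<sigma>"
      unfolding not_lex_less_iff by (metis order_less_le)
    then show ?thesis
      unfolding lex_le_def lex_less_iff by blast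
  qed (simp add: lex_le_def)
next
  assume "lex_le \<omega> \<sigma>"
  then show "\<not> lex_less \<sigma> \<omega>"
    unfolding lex_le_def
  proof
    assume "lex_less \<omega> \<sigma>"
    then obtain k where k: "\<forall>j<k. \<omega> !! j = \<sigma> !! j" "\<omega> !! k < \<sigma> !! k"
      unfolding lex_less_def by blast
    show ?thesis
    proof
      assume "lex_less \<sigma> \<omega>"
      then obtain l where l: "\<forall>j<l. \<sigma> !! j = \<omega> !! j" "\<sigma> !! l < \<omega> !! l"
        unfolding lex_less_def by blast
      from k l show False
        by (cases l k rule: linorder_cases) auto
    qed
  qed (simp add: lex_less_def)
qed

lemma lex_less_unfold:
  "lex_less \<sigma> \<omega> \<longleftrightarrow> shd \<sigma> < shd \<omega> \<or> shd \<sigma> = shd \<omega> \<and> lex_less (stl \<sigma>) (stl \<omega>)"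
proof -
  have "lex_less \<sigma> \<omega> \<longleftrightarrow> (\<exists>n. stake (Suc n) \<sigma> < stake (Suc n) \<omega>)"
    unfolding lex_less_iff
    by (metis not0_implies_Suc order_less_irrefl stake.simps(1))
  then show ?thesis
    by (auto simp: lex_less_iff)
qed

text \<open>Once the prefix is read, only a shift of \<omega> is left to compare with \<tau>. This
  later reduces the admissibility of a tail to comparisons with the orbits of \<alpha> and
  \<beta>.\<close>

lemma lex_less_shift_right:
  "lex_less \<omega> (v @- \<tau>) \<longleftrightarrow>
     stake (length v) \<omega> < v \<or> stake (length v) \<omega> = v \<and> lex_less (sdrop (length v) \<omega>) \<tau>"
proof (induction v arbitrary: \<omega>)
  case (Cons x v)
  show ?case
    by (subst lex_less_unfold) (auto simp: Cons.IH)
qed simp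

lemma lex_le_shift_left:
  "lex_le (v @- \<tau>) \<omega> \<longleftrightarrow>
     v < stake (length v) \<omega> \<or> v = stake (length v) \<omega> \<and> lex_le \<tau> (sdrop (length v) \<omega>)"
  unfolding not_lex_less[symmetric] lex_less_shift_right by auto


section \<open>Counting words\<close>

text \<open>
  Excluding only the open interval gives a set that contains both \<open>\<Omega>\<close>-sets of the pair and both
  \<open>\<alpha>\<close> and \<open>\<beta>\<close>, so that its word counts satisfy recursions without boundary corrections.
\<close>

definition Omega_hull :: "bool stream \<Rightarrow> bool stream \<Rightarrow> bool stream set" where
  "Omega_hull \<alpha> \<beta> = {\<omega>. \<forall>n. \<not> (lex_less \<alpha> (sdrop n \<omega>) \<and> lex_less (sdrop n \<omega>) \<beta>)}"

definition hull_words :: "bool stream \<Rightarrow> bool stream \<Rightarrow> nat \<Rightarrow> bool list set" where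
  "hull_words \<alpha> \<beta> n = stake n ` Omega_hull \<alpha> \<beta>"

definition hull_rank :: "bool stream \<Rightarrow> bool stream \<Rightarrow> nat \<Rightarrow> bool stream \<Rightarrow> nat" where
  "hull_rank \<alpha> \<beta> n \<omega> = card {w \<in> hull_words \<alpha> \<beta> n. w < stake n \<omega>}"

text \<open>The number of words of length \<open>n\<close> that can be preceded by either digit.\<close>

definition branch_count :: "bool stream \<Rightarrow> bool stream \<Rightarrow> nat \<Rightarrow> real" where
  "branch_count \<alpha> \<beta> n =
     real (hull_rank \<alpha> \<beta> n (stl \<alpha>)) + 1 - real (hull_rank \<alpha> \<beta> n (stl \<beta>))"

lemma Omega_pair_subset_hull: "Omega_pair \<alpha> \<beta> \<subseteq> Omega_hull \<alpha> \<beta>"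
  by (auto simp: Omega_pair_def Omega_minus_def Omega_plus_def Omega_hull_def
      lex_Ioc_def lex_Ico_def lex_le_def)

lemma finite_hull_words [simp]: "finite (hull_words \<alpha> \<beta> n)"
proof (rule finite_subset)
  show "hull_words \<alpha> \<beta> n \<subseteq> {w. set w \<subseteq> UNIV \<and> length w = n}"
    by (auto simp: hull_words_def)
qed (rule finite_lists_length_eq, simp)

lemma sdrop_Omega_hull: "\<omega> \<in> Omega_hull \<alpha> \<beta> \<Longrightarrow> sdrop n \<omega> \<in> Omega_hull \<alpha> \<beta>"
  by (auto simp: Omega_hull_def)

lemma stl_Omega_hull: "\<omega> \<in> Omega_hull \<alpha> \<beta> \<Longrightarrow> stl \<omega> \<in> Omega_hull \<alpha> \<beta>"
  using sdrop_Omega_hull[of \<omega> \<alpha> \<beta> 1] by simp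

lemma Omega_hull_iff_stl:
  "\<omega> \<in> Omega_hull \<alpha> \<beta> \<longleftrightarrow>
     \<not> (lex_less \<alpha> \<omega> \<and> lex_less \<omega> \<beta>) \<and> stl \<omega> \<in> Omega_hull \<alpha> \<beta>"
proof
  assume h: "\<not> (lex_less \<alpha> \<omega> \<and> lex_less \<omega> \<beta>) \<and> stl \<omega> \<in> Omega_hull \<alpha> \<beta>"
  show "\<omega> \<in> Omega_hull \<alpha> \<beta>"
    unfolding Omega_hull_def
  proof (intro CollectI allI)
    fix n
    from h show "\<not> (lex_less \<alpha> (sdrop n \<omega>) \<and> lex_less (sdrop n \<omega>) \<beta>)"
      by (cases n) (auto simp: Omega_hull_def)
  qed
next
  assume h: "\<omega> \<in> Omega_hull \<alpha> \<beta>"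
  then have "\<not> (lex_less \<alpha> (sdrop 0 \<omega>) \<and> lex_less (sdrop 0 \<omega>) \<beta>)"
    unfolding Omega_hull_def by blast
  with h show "\<not> (lex_less \<alpha> \<omega> \<and> lex_less \<omega> \<beta>) \<and> stl \<omega> \<in> Omega_hull \<alpha> \<beta>"
    by (simp add: stl_Omega_hull)
qed

lemma admissible_Omega_hull:
  assumes "admissible \<alpha> \<beta>"
  shows "\<alpha> \<in> Omega_hull \<alpha> \<beta>" "\<beta> \<in> Omega_hull \<alpha> \<beta>"
  using assms by (auto simp: admissible_def Omega_hull_def lex_Ioc_def lex_Ico_def lex_le_def)

lemma admissible_shd:
  assumes "admissible \<alpha> \<beta>"
  shows "\<not> shd \<alpha>" "shd \<beta>" "shd (stl \<alpha>)" "\<not> shd (stl \<beta>)"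
  using assms by (auto simp: admissible_def)

text \<open>The greatest string is never below \<beta>. Its rank counts all hull words but one, so
  the total count obeys the same recursion as the ranks.\<close>

lemma sconst_True_Omega_hull: "sconst True \<in> Omega_hull \<alpha> \<beta>"
proof -
  have "\<not> lex_less (sconst True) \<beta>"
    by (auto simp: lex_less_def)
  then show ?thesis
    by (simp add: Omega_hull_def)
qed

text \<open>A string starting with 0 is below \<beta>, so membership in the hull keeps it from
  exceeding \<alpha>; the common first digit is then removed.\<close>

lemma Omega_hull_le_left:
  assumes "admissible \<alpha> \<beta>" "\<omega> \<in> Omega_hull \<alpha> \<beta>" "\<not> shd \<omega>"
  shows "stake n (stl \<omega>) \<le> stake n (stl \<alpha>)"
proof -
  have "lex_less \<omega> \<beta>"
    using assms(3) admissible_shd[OF assms(1)] by (subst lex_less_unfold) simp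
  then have "\<not> lex_less \<alpha> \<omega>"
    using assms(2) Omega_hull_iff_stl by blast
  then have "stake (Suc n) \<omega> \<le> stake (Suc n) \<alpha>"
    unfolding not_lex_less_iff by blast
  then show ?thesis
    using assms(3) admissible_shd[OF assms(1)] by simp
qed

lemma Omega_hull_ge_right:
  assumes "admissible \<alpha> \<beta>" "\<omega> \<in> Omega_hull \<alpha> \<beta>" "shd \<omega>"
  shows "stake n (stl \<beta>) \<le> stake n (stl \<omega>)"
proof -
  have "lex_less \<alpha> \<omega>"
    using assms(3) admissible_shd[OF assms(1)] by (subst lex_less_unfold) simp
  then have "\<not> lex_less \<omega> \<beta>"
    using assms(2) Omega_hull_iff_stl by blast
  then have "stake (Suc n) \<beta> \<le> stake (Suc n) \<omega>"
    unfolding not_lex_less_iff by blast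
  then show ?thesis
    using assms(3) admissible_shd[OF assms(1)] by simp
qed

text \<open>If w differs from the prefix of \<open>stl \<alpha>\<close>, the comparison with
  \<alpha> is decided within w and any hull extension of w will do. If it is that prefix, an
  extension might exceed \<alpha>, and \<alpha> itself is the witness.\<close>

lemma False_Cons_hull_words_iff:
  assumes adm: "admissible \<alpha> \<beta>"
  shows "False # w \<in> hull_words \<alpha> \<beta> (Suc n) \<longleftrightarrow>
    w \<in> hull_words \<alpha> \<beta> n \<and> w \<le> stake n (stl \<alpha>)"
proof
  assume "False # w \<in> hull_words \<alpha> \<beta> (Suc n)"
  then obtain \<omega> where "\<omega> \<in> Omega_hull \<alpha> \<beta>" "\<not> shd \<omega>" "w = stake n (stl \<omega>)"
    by (auto simp: hull_words_def)
  then show "w \<in> hull_words \<alpha> \<beta> n \<and> w \<le> stake n (stl \<alpha>)"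
    using Omega_hull_le_left[OF adm] stl_Omega_hull by (auto simp: hull_words_def)
next
  assume w: "w \<in> hull_words \<alpha> \<beta> n \<and> w \<le> stake n (stl \<alpha>)"
  show "False # w \<in> hull_words \<alpha> \<beta> (Suc n)"
  proof (cases "w = stake n (stl \<alpha>)")
    case True
    then have "False # w = stake (Suc n) \<alpha>"
      using admissible_shd[OF adm] by simp
    then show ?thesis
      unfolding hull_words_def using admissible_Omega_hull[OF adm] by blast
  next
    case False
    from w obtain \<tau> where \<tau>: "\<tau> \<in> Omega_hull \<alpha> \<beta>" "w = stake n \<tau>"
      by (auto simp: hull_words_def)
    from False w \<tau> have "stake (Suc n) (False ## \<tau>) < stake (Suc n) \<alpha>"
      using admissible_shd[OF adm] by (simp add: order_less_le)
    then have "lex_less (False ## \<tau>) \<alpha>"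
      unfolding lex_less_iff by (auto simp del: stake.simps)
    then have "\<not> lex_less \<alpha> (False ## \<tau>)"
      unfolding not_lex_less by (simp add: lex_le_def)
    then have "False ## \<tau> \<in> Omega_hull \<alpha> \<beta>"
      using \<tau> by (subst Omega_hull_iff_stl) simp
    moreover have "False # w = stake (Suc n) (False ## \<tau>)"
      using \<tau> by simp
    ultimately show ?thesis
      unfolding hull_words_def by blast
  qed
qed

lemma True_Cons_hull_words_iff:
  assumes adm: "admissible \<alpha> \<beta>"
  shows "True # w \<in> hull_words \<alpha> \<beta> (Suc n) \<longleftrightarrow>
    w \<in> hull_words \<alpha> \<beta> n \<and> stake n (stl \<beta>) \<le> w"
proof
  assume "True # w \<in> hull_words \<alpha> \<beta> (Suc n)"
  then obtain \<omega> where "\<omega> \<in> Omega_hull \<alpha> \<beta>" "shd \<omega>" "w = stake n (stl \<omega>)"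
    by (auto simp: hull_words_def)
  then show "w \<in> hull_words \<alpha> \<beta> n \<and> stake n (stl \<beta>) \<le> w"
    using Omega_hull_ge_right[OF adm] stl_Omega_hull by (auto simp: hull_words_def)
next
  assume w: "w \<in> hull_words \<alpha> \<beta> n \<and> stake n (stl \<beta>) \<le> w"
  show "True # w \<in> hull_words \<alpha> \<beta> (Suc n)"
  proof (cases "w = stake n (stl \<beta>)")
    case True
    then have "True # w = stake (Suc n) \<beta>"
      using admissible_shd[OF adm] by simp
    then show ?thesis
      unfolding hull_words_def using admissible_Omega_hull[OF adm] by blast
  next
    case False
    from w obtain \<tau> where \<tau>: "\<tau> \<in> Omega_hull \<alpha> \<beta>" "w = stake n \<tau>"
      by (auto simp: hull_words_def)
    from False w \<tau> have "stake (Suc n) \<beta> < stake (Suc n) (True ## \<tau>)"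
      using admissible_shd[OF adm] by (simp add: order_less_le)
    then have "lex_less \<beta> (True ## \<tau>)"
      unfolding lex_less_iff by (auto simp del: stake.simps)
    then have "\<not> lex_less (True ## \<tau>) \<beta>"
      unfolding not_lex_less by (simp add: lex_le_def)
    then have "True ## \<tau> \<in> Omega_hull \<alpha> \<beta>"
      using \<tau> by (subst Omega_hull_iff_stl) simp
    moreover have "True # w = stake (Suc n) (True ## \<tau>)"
      using \<tau> by simp
    ultimately show ?thesis
      unfolding hull_words_def by blast
  qed
qed

section \<open>Recursion for ranks and word counts\<close>

lemma length_hull_words: "w \<in> hull_words \<alpha> \<beta> n \<Longrightarrow> length w = n"
  by (auto simp: hull_words_def)

lemma stake_in_hull_words: "\<omega> \<in> Omega_hull \<alpha> \<beta> \<Longrightarrow> stake n \<omega> \<in> hull_words \<alpha> \<beta> n"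
  by (simp add: hull_words_def)

lemma card_hull_words_atMost:
  assumes "\<omega> \<in> Omega_hull \<alpha> \<beta>"
  shows "card {w \<in> hull_words \<alpha> \<beta> n. w \<le> stake n \<omega>} = hull_rank \<alpha> \<beta> n \<omega> + 1"
proof -
  have "{w \<in> hull_words \<alpha> \<beta> n. w \<le> stake n \<omega>} =
      insert (stake n \<omega>) {w \<in> hull_words \<alpha> \<beta> n. w < stake n \<omega>}"
    using stake_in_hull_words[OF assms] by auto
  then show ?thesis
    by (simp add: hull_rank_def)
qed

text \<open>Below a string starting with 0 there are only words 0v with v below its tail. Below a
  string starting with 1 there are all hull words 0v, where v is at most
  \<open>stl \<alpha>\<close>, and the words 1v with v from \<open>stl \<beta>\<close> up to the
  tail. The excess in the second case is \<open>branch_count\<close>, whatever \<omega> is.\<close>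

lemma hull_rank_Suc:
  assumes adm: "admissible \<alpha> \<beta>" and \<omega>: "\<omega> \<in> Omega_hull \<alpha> \<beta>"
  shows "real (hull_rank \<alpha> \<beta> (Suc n) \<omega>) =
    real (hull_rank \<alpha> \<beta> n (stl \<omega>)) + of_bool (shd \<omega>) * branch_count \<alpha> \<beta> n"
proof -
  let ?W = "hull_words \<alpha> \<beta>"
  note [simp] = False_Cons_hull_words_iff[OF adm] True_Cons_hull_words_iff[OF adm]
  have split: "\<exists>d v. w = d # v" if "w \<in> ?W (Suc n)" for w
    using length_hull_words[OF that] by (auto simp: length_Suc_conv)
  show ?thesis
  proof (cases "shd \<omega>")
    case False
    have "{w \<in> ?W (Suc n). w < stake (Suc n) \<omega>} =
        (#) False ` {w \<in> ?W n. w < stake n (stl \<omega>)}"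
      (is "?L = ?R")
    proof (intro equalityI subsetI)
      fix w assume "w \<in> ?L"
      then obtain d v where "w = d # v" "d # v \<in> ?W (Suc n)" "d # v < stake (Suc n) \<omega>"
        using split by blast
      with False show "w \<in> ?R"
        by auto
    next
      fix w assume "w \<in> ?R"
      then show "w \<in> ?L"
        using False Omega_hull_le_left[OF adm \<omega> False, of n] by auto
    qed
    then have "hull_rank \<alpha> \<beta> (Suc n) \<omega> = hull_rank \<alpha> \<beta> n (stl \<omega>)"
      unfolding hull_rank_def by (simp add: card_image)
    with False show ?thesis
      by simp
  next
    case True
    note ge = Omega_hull_ge_right[OF adm \<omega> True, of n]
    let ?A = "(#) False ` {w \<in> ?W n. w \<le> stake n (stl \<alpha>)}"
    let ?C = "{w \<in> ?W n. w < stake n (stl \<omega>)} - {w \<in> ?W n. w < stake n (stl \<beta>)}"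
    let ?B = "(#) True ` ?C"
    have "{w \<in> ?W (Suc n). w < stake (Suc n) \<omega>} = ?A \<union> ?B"
      (is "?L = ?R")
    proof (intro equalityI subsetI)
      fix w assume "w \<in> ?L"
      then obtain d v where "w = d # v" "d # v \<in> ?W (Suc n)" "d # v < stake (Suc n) \<omega>"
        using split by blast
      with True show "w \<in> ?R"
        by (cases d) auto
    next
      fix w assume "w \<in> ?R"
      then show "w \<in> ?L"
        using True by auto
    qed
    then have "hull_rank \<alpha> \<beta> (Suc n) \<omega> = card ?A + card ?B"
      unfolding hull_rank_def by (subst card_Un_disjoint[symmetric]) auto
    also have "card ?A = hull_rank \<alpha> \<beta> n (stl \<alpha>) + 1"
      using admissible_Omega_hull(1)[OF adm]
      by (simp add: card_image card_hull_words_atMost stl_Omega_hull)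
    finally have "hull_rank \<alpha> \<beta> (Suc n) \<omega> = hull_rank \<alpha> \<beta> n (stl \<alpha>) + 1 + card ?C"
      by (simp add: card_image)
    \<comment> \<open>By \<open>ge\<close> the subtracted set is contained in the other one, so the
      cardinalities subtract.\<close>
    moreover have "real (card ?C) = real (hull_rank \<alpha> \<beta> n (stl \<omega>)) - real (hull_rank \<alpha> \<beta> n (stl \<beta>))"
      unfolding hull_rank_def using ge
      by (subst card_Diff_subset) (auto intro!: of_nat_diff card_mono)
    ultimately show ?thesis
      using True by (simp add: branch_count_def)
  qed
qed

text \<open>The recursion is iterated along the orbit of \<omega>: after digit k is read, n - k - 1
  digits remain.\<close>

lemma hull_rank_eq_sum:
  assumes adm: "admissible \<alpha> \<beta>" and "\<omega> \<in> Omega_hull \<alpha> \<beta>"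
  shows "real (hull_rank \<alpha> \<beta> n \<omega>) =
    (\<Sum>k<n. of_bool (\<omega> !! k) * branch_count \<alpha> \<beta> (n - Suc k))"
  using assms(2)
proof (induction n arbitrary: \<omega>)
  case 0
  show ?case
    by (simp add: hull_rank_def)
next
  case (Suc n)
  show ?case
    using Suc.IH[OF stl_Omega_hull[OF Suc.prems]]
    by (simp add: hull_rank_Suc[OF adm Suc.prems] sum.lessThan_Suc_shift del: sum.lessThan_Suc)
qed

lemma card_hull_words:
  assumes adm: "admissible \<alpha> \<beta>"
  shows "real (card (hull_words \<alpha> \<beta> n)) = 1 + (\<Sum>k<n. branch_count \<alpha> \<beta> k)"
proof -
  have "w \<le> stake n (sconst True)" if "length w = n" for w :: "bool list" and n
    using that by (induction w arbitrary: n) (auto simp del: stake_siterate)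
  then have "{w \<in> hull_words \<alpha> \<beta> n. w \<le> stake n (sconst True)} = hull_words \<alpha> \<beta> n"
    using length_hull_words by blast
  then have "real (card (hull_words \<alpha> \<beta> n)) = 1 + real (hull_rank \<alpha> \<beta> n (sconst True))"
    using card_hull_words_atMost[OF sconst_True_Omega_hull, of \<alpha> \<beta> n] by simp
  also have "real (hull_rank \<alpha> \<beta> n (sconst True)) = (\<Sum>k<n. branch_count \<alpha> \<beta> (n - Suc k))"
    by (simp add: hull_rank_eq_sum[OF adm sconst_True_Omega_hull])
  also have "\<dots> = (\<Sum>k<n. branch_count \<alpha> \<beta> k)"
    by (rule sum.nat_diff_reindex)
  finally show ?thesis .
qed

text \<open>No hull string lies strictly between \<alpha> and \<beta>, so the words below \<beta>
  are those at most \<alpha>. The length must be positive, since the empty prefixes of \<alpha> and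
  \<beta> coincide.\<close>

lemma hull_rank_diff:
  assumes adm: "admissible \<alpha> \<beta>"
  shows "hull_rank \<alpha> \<beta> (Suc n) \<beta> = hull_rank \<alpha> \<beta> (Suc n) \<alpha> + 1"
proof -
  have "{w \<in> hull_words \<alpha> \<beta> (Suc n). w < stake (Suc n) \<beta>} =
      {w \<in> hull_words \<alpha> \<beta> (Suc n). w \<le> stake (Suc n) \<alpha>}" (is "?L = ?R")
  proof (intro equalityI subsetI)
    fix w assume w: "w \<in> ?L"
    then obtain \<omega> where \<omega>: "\<omega> \<in> Omega_hull \<alpha> \<beta>" "w = stake (Suc n) \<omega>"
      by (auto simp: hull_words_def)
    with w have "lex_less \<omega> \<beta>"
      unfolding lex_less_iff by blast
    with \<omega> have "\<not> lex_less \<alpha> \<omega>"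
      using Omega_hull_iff_stl by blast
    with w \<omega> show "w \<in> ?R"
      unfolding not_lex_less_iff by blast
  next
    fix w assume "w \<in> ?R"
    moreover have "stake (Suc n) \<alpha> < stake (Suc n) \<beta>"
      using admissible_shd[OF adm] by simp
    ultimately show "w \<in> ?L"
      by (auto simp del: stake.simps)
  qed
  then show ?thesis
    using card_hull_words_atMost[OF admissible_Omega_hull(1)[OF adm], of "Suc n"]
    by (simp only: hull_rank_def)
qed

section \<open>Convolution identities for the kneading coefficients\<close>

definition kneading_coeff :: "bool stream \<Rightarrow> bool stream \<Rightarrow> nat \<Rightarrow> real" where
  "kneading_coeff \<alpha> \<beta> n = of_bool (\<beta> !! n) - of_bool (\<alpha> !! n)"

text \<open>Subtracting the rank formula of \<alpha> from that of \<beta> leaves the rank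
  difference, which is 1.\<close>

lemma kneading_convolution_branch_count:
  assumes adm: "admissible \<alpha> \<beta>"
  shows "(\<Sum>k\<le>n. kneading_coeff \<alpha> \<beta> k * branch_count \<alpha> \<beta> (n - k)) = 1"
proof -
  have "(\<Sum>k<Suc n. kneading_coeff \<alpha> \<beta> k * branch_count \<alpha> \<beta> (Suc n - Suc k)) = 1"
    unfolding kneading_coeff_def left_diff_distrib sum_subtractf
    using hull_rank_eq_sum[OF adm admissible_Omega_hull(1)[OF adm], of "Suc n"]
      hull_rank_eq_sum[OF adm admissible_Omega_hull(2)[OF adm], of "Suc n"]
      hull_rank_diff[OF adm, of n]
    by linarith
  then show ?thesis
    by (simp add: lessThan_Suc_atMost)
qed

text \<open>The word count minus 1 is a partial sum of \<open>branch_count\<close>, so this is the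
  previous identity summed over lengths.\<close>

lemma kneading_convolution_card:
  assumes adm: "admissible \<alpha> \<beta>"
  shows "(\<Sum>k\<le>n. kneading_coeff \<alpha> \<beta> k * (real (card (hull_words \<alpha> \<beta> (n - k))) - 1)) = real n"
proof (induction n)
  case (Suc n)
  \<comment> \<open>The last term vanishes because there is exactly one word of length 0.\<close>
  have "(\<Sum>k\<le>Suc n. kneading_coeff \<alpha> \<beta> k * (real (card (hull_words \<alpha> \<beta> (Suc n - k))) - 1)) =
      (\<Sum>k\<le>n. kneading_coeff \<alpha> \<beta> k * (real (card (hull_words \<alpha> \<beta> (Suc n - k))) - 1))"
    by (simp add: card_hull_words[OF adm])
  also have "\<dots> = (\<Sum>k\<le>n. kneading_coeff \<alpha> \<beta> k * (real (card (hull_words \<alpha> \<beta> (n - k))) - 1)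
      + kneading_coeff \<alpha> \<beta> k * branch_count \<alpha> \<beta> (n - k))"
    by (rule sum.cong) (auto simp: card_hull_words[OF adm] Suc_diff_le algebra_simps)
  also have "\<dots> = real n + 1"
    by (simp only: sum.distrib Suc.IH kneading_convolution_branch_count[OF adm])
  finally show ?case
    by simp
qed (simp add: card_hull_words[OF adm])

lemma card_hull_words_submultiplicative:
  "card (hull_words \<alpha> \<beta> (m + n)) \<le> card (hull_words \<alpha> \<beta> m) * card (hull_words \<alpha> \<beta> n)"
proof -
  have "hull_words \<alpha> \<beta> (m + n) \<subseteq> (\<lambda>(u, v). u @ v) ` (hull_words \<alpha> \<beta> m \<times> hull_words \<alpha> \<beta> n)"
  proof
    fix w assume "w \<in> hull_words \<alpha> \<beta> (m + n)"
    then obtain \<omega> where "\<omega> \<in> Omega_hull \<alpha> \<beta>" "w = stake m \<omega> @ stake n (sdrop m \<omega>)"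
      by (auto simp: hull_words_def)
    then show "w \<in> (\<lambda>(u, v). u @ v) ` (hull_words \<alpha> \<beta> m \<times> hull_words \<alpha> \<beta> n)"
      using sdrop_Omega_hull[of \<omega> \<alpha> \<beta> m] stake_in_hull_words
      by (intro image_eqI[of _ _ "(stake m \<omega>, stake n (sdrop m \<omega>))"]) auto
  qed
  then have "card (hull_words \<alpha> \<beta> (m + n)) \<le> card (hull_words \<alpha> \<beta> m \<times> hull_words \<alpha> \<beta> n)"
    by (intro surj_card_le) auto
  then show ?thesis
    by simp
qed

section \<open>Existence of the base\<close>

text \<open>Splitting off blocks of length m, each costing a factor below 1, bounds g by a geometric
  sequence.\<close>

lemma submultiplicative_summable:
  fixes g :: "nat \<Rightarrow> real"
  assumes sub: "\<And>m n. g (m + n) \<le> g m * g n" and nn: "\<And>n. 0 \<le> g n"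
    and m: "m > 0" "g m < 1"
  shows "summable g"
proof -
  \<comment> \<open>A number strictly above \<open>g m\<close> keeps the ratio t positive even when
    \<open>g m = 0\<close>.\<close>
  obtain q where q: "g m < q" "q < 1"
    using m(2) dense by blast
  then have "0 < q"
    using nn[of m] by simp
  define t where "t = root m q"
  have t: "0 < t" "t < 1" "t ^ m = q"
    using \<open>0 < q\<close> \<open>q < 1\<close> m(1) by (auto simp: t_def)
  \<comment> \<open>This constant covers the lengths below m, where the splitting stops.\<close>
  define C where "C = Max ((\<lambda>j. g j / t ^ j) ` {..<m})"
  have bound: "g n \<le> C * t ^ n" for n
  proof (induction n rule: less_induct)
    case (less n)
    show ?case
    proof (cases "n < m")
      case True
      then have "g n / t ^ n \<le> C"
        unfolding C_def by (intro Max_ge) auto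
      then show ?thesis
        using t by (simp add: field_simps)
    next
      case False
      then have "g n \<le> g (n - m) * g m"
        using sub[of "n - m" m] by simp
      also have "\<dots> \<le> (C * t ^ (n - m)) * t ^ m"
        using less.IH[of "n - m"] False m q t nn[of m] nn[of "n - m"]
        by (intro mult_mono) auto
      also have "\<dots> = C * t ^ n"
        using False by (simp add: power_add[symmetric])
      finally show ?thesis .
    qed
  qed
  show ?thesis
  proof (rule summable_comparison_test)
    show "\<exists>N. \<forall>n\<ge>N. norm (g n) \<le> C * t ^ n"
      using bound nn by auto
    show "summable (\<lambda>n. C * t ^ n)"
      using t by (intro summable_mult summable_geometric) auto
  qed
qed

section \<open>Power series with bounded coefficients\<close>

lemma summable_bounded_power_series:
  fixes c :: "nat \<Rightarrow> real"
  assumes "\<And>n. \<bar>c n\<bar> \<le> 1" "\<bar>x\<bar> < 1"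
  shows "summable (\<lambda>n. norm (c n * x ^ n))"
proof (rule summable_comparison_test)
  show "\<exists>N. \<forall>n\<ge>N. norm (norm (c n * x ^ n)) \<le> \<bar>x\<bar> ^ n"
    using assms(1) by (auto simp: abs_mult power_abs intro!: mult_left_le_one_le)
  show "summable (\<lambda>n. \<bar>x\<bar> ^ n)"
    using assms(2) by (intro summable_geometric) auto
qed

lemma continuous_on_bounded_power_series:
  fixes c :: "nat \<Rightarrow> real"
  assumes "\<And>n. \<bar>c n\<bar> \<le> 1"
  shows "continuous_on {-1<..<1} (\<lambda>x. \<Sum>n. c n * x ^ n)"
proof (rule continuous_at_imp_continuous_on, rule ballI)
  fix x :: real assume x: "x \<in> {-1<..<1}"
  then have "\<bar>x\<bar> < 1"
    by auto
  then obtain K where K: "\<bar>x\<bar> < K" "K < 1"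
    using dense by blast
  show "isCont (\<lambda>x. \<Sum>n. c n * x ^ n) x"
    using summable_bounded_power_series[OF assms, of K] K
    by (intro isCont_powser[of _ K]) (auto intro: summable_norm_cancel)
qed

lemma abs_kneading_coeff_le: "\<bar>kneading_coeff \<alpha> \<beta> n\<bar> \<le> 1"
  by (simp add: kneading_coeff_def)

lemma suminf_digits_bounds:
  fixes x :: real
  assumes "0 \<le> x" "x < 1"
  shows "summable (\<lambda>n. of_bool (\<omega> !! n) * x ^ n)"
    and "(\<Sum>n. of_bool (\<omega> !! n) * x ^ n) \<in> {0..1 / (1 - x)}"
proof -
  show s: "summable (\<lambda>n. of_bool (\<omega> !! n) * x ^ n)"
    using summable_bounded_power_series[of "\<lambda>n. of_bool (\<omega> !! n)" x] assms
    by (auto intro: summable_norm_cancel)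
  have "(\<Sum>n. of_bool (\<omega> !! n) * x ^ n) \<le> (\<Sum>n. x ^ n)"
    using assms s by (intro suminf_le summable_geometric) (auto simp: of_bool_def)
  then show "(\<Sum>n. of_bool (\<omega> !! n) * x ^ n) \<in> {0..1 / (1 - x)}"
    using assms s by (auto intro!: suminf_nonneg simp: suminf_geometric)
qed

lemma suminf_digits_unfold:
  fixes x :: real
  assumes "0 \<le> x" "x < 1"
  shows "(\<Sum>n. of_bool (\<omega> !! n) * x ^ n) =
    of_bool (shd \<omega>) + x * (\<Sum>n. of_bool (stl \<omega> !! n) * x ^ n)"
proof -
  have "(\<Sum>n. of_bool (\<omega> !! n) * x ^ n) =
      of_bool (\<omega> !! 0) * x ^ 0 + (\<Sum>n. of_bool (\<omega> !! Suc n) * x ^ Suc n)"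
    using suminf_split_head[OF suminf_digits_bounds(1)[OF assms, of \<omega>]] by simp
  also have "(\<Sum>n. of_bool (\<omega> !! Suc n) * x ^ Suc n) =
      (\<Sum>n. x * (of_bool (stl \<omega> !! n) * x ^ n))"
    by (simp add: mult_ac)
  also have "\<dots> = x * (\<Sum>n. of_bool (stl \<omega> !! n) * x ^ n)"
    using suminf_digits_bounds(1)[OF assms] by (rule suminf_mult)
  finally show ?thesis
    by simp
qed

lemma suminf_kneading_coeff:
  fixes x :: real
  assumes "0 \<le> x" "x < 1"
  shows "(\<Sum>n. kneading_coeff \<alpha> \<beta> n * x ^ n) =
    (\<Sum>n. of_bool (\<beta> !! n) * x ^ n) - (\<Sum>n. of_bool (\<alpha> !! n) * x ^ n)"
  unfolding kneading_coeff_def left_diff_distrib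
  by (rule suminf_diff[symmetric]) (rule suminf_digits_bounds(1)[OF assms])+

text \<open>At 1/2 the series of a string starting with 1 is at least 1, and that of a string
  starting with 0 is at most 1, since a tail contributes at most half of 2.\<close>

lemma kneading_half_nonneg:
  assumes "admissible \<alpha> \<beta>"
  shows "0 \<le> (\<Sum>n. kneading_coeff \<alpha> \<beta> n * (1/2) ^ n)"
proof -
  have h: "(0::real) \<le> 1/2" "(1::real)/2 < 1"
    by auto
  show ?thesis
    unfolding suminf_kneading_coeff[OF h] suminf_digits_unfold[OF h, of \<beta>]
      suminf_digits_unfold[OF h, of \<alpha>]
    using admissible_shd[OF assms] suminf_digits_bounds(2)[OF h, of "stl \<beta>"]
      suminf_digits_bounds(2)[OF h, of "stl \<alpha>"]
    by simp
qed

lemma card_hull_words_ge_1: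
  assumes "admissible \<alpha> \<beta>"
  shows "1 \<le> real (card (hull_words \<alpha> \<beta> n))"
proof -
  have "hull_words \<alpha> \<beta> n \<noteq> {}"
    using stake_in_hull_words[OF admissible_Omega_hull(1)[OF assms]] by blast
  then have "0 < card (hull_words \<alpha> \<beta> n)"
    by (simp add: card_gt_0_iff)
  then show ?thesis
    by linarith
qed

text \<open>By the Cauchy product and the convolution identity, the product of the full series is
  the sum of \<open>n * x ^ n\<close>, which is dominated by the derivative of the geometric series.
  A finite partial sum is kept so that x can later tend to the boundary of convergence with K
  fixed.\<close>

lemma kneading_times_partial_sum_le:
  assumes adm: "admissible \<alpha> \<beta>" and x: "0 < x" "x < 1"
    and s: "summable (\<lambda>n. real (card (hull_words \<alpha> \<beta> n)) * x ^ n)"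
    and pos: "0 \<le> (\<Sum>n. kneading_coeff \<alpha> \<beta> n * x ^ n)"
  shows "(\<Sum>n. kneading_coeff \<alpha> \<beta> n * x ^ n) *
    (\<Sum>n<K. (real (card (hull_words \<alpha> \<beta> n)) - 1) * x ^ n) \<le> 1 / (1 - x)\<^sup>2"
proof -
  define a where "a n = real (card (hull_words \<alpha> \<beta> n)) - 1" for n
  have a: "0 \<le> a n" for n
    using card_hull_words_ge_1[OF adm, of n] by (simp add: a_def)
  have sa: "summable (\<lambda>n. a n * x ^ n)"
    unfolding a_def left_diff_distrib using s x
    by (intro summable_diff) (auto intro!: summable_geometric)
  have "(\<lambda>n. \<Sum>k\<le>n. kneading_coeff \<alpha> \<beta> k * x ^ k * (a (n - k) * x ^ (n - k)))
      sums ((\<Sum>n. kneading_coeff \<alpha> \<beta> n * x ^ n) * (\<Sum>n. a n * x ^ n))"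
    using summable_bounded_power_series[OF abs_kneading_coeff_le] sa a x
    by (intro Cauchy_product_sums) auto
  moreover have "(\<Sum>k\<le>n. kneading_coeff \<alpha> \<beta> k * x ^ k * (a (n - k) * x ^ (n - k))) = real n * x ^ n"
    for n
  proof -
    have "(\<Sum>k\<le>n. kneading_coeff \<alpha> \<beta> k * x ^ k * (a (n - k) * x ^ (n - k))) =
        (\<Sum>k\<le>n. kneading_coeff \<alpha> \<beta> k * a (n - k) * x ^ n)"
    proof (rule sum.cong)
      fix k assume "k \<in> {..n}"
      then have "x ^ n = x ^ k * x ^ (n - k)"
        by (simp add: power_add[symmetric])
      then show "kneading_coeff \<alpha> \<beta> k * x ^ k * (a (n - k) * x ^ (n - k)) =
          kneading_coeff \<alpha> \<beta> k * a (n - k) * x ^ n"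
        by (simp add: mult_ac)
    qed simp
    then show ?thesis
      using kneading_convolution_card[OF adm, of n] by (simp add: sum_distrib_right[symmetric] a_def)
  qed
  ultimately have prod: "(\<lambda>n. real n * x ^ n) sums
      ((\<Sum>n. kneading_coeff \<alpha> \<beta> n * x ^ n) * (\<Sum>n. a n * x ^ n))"
    by simp
  have "(\<Sum>n<K. a n * x ^ n) \<le> (\<Sum>n. a n * x ^ n)"
    using a x by (intro sum_le_suminf sa) auto
  then have "(\<Sum>n. kneading_coeff \<alpha> \<beta> n * x ^ n) * (\<Sum>n<K. a n * x ^ n) \<le>
      (\<Sum>n. kneading_coeff \<alpha> \<beta> n * x ^ n) * (\<Sum>n. a n * x ^ n)"
    using pos by (intro mult_left_mono)
  also have "\<dots> \<le> 1 / (1 - x)\<^sup>2"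
  proof (rule sums_le[OF _ prod])
    show "(\<lambda>n. real (Suc n) * x ^ n) sums (1 / (1 - x)\<^sup>2)"
      using geometric_deriv_sums[of x] x by simp
    show "real n * x ^ n \<le> real (Suc n) * x ^ n" for n
      using x by (intro mult_right_mono) auto
  qed
  finally show ?thesis
    by (simp add: a_def)
qed

text \<open>For c strictly between 0 and the limit superior, infinitely many word counts exceed
  \<open>exp (c * n)\<close>; then r is \<open>exp (- c)\<close>.\<close>

lemma entropy_pos_frequently:
  assumes "entropy \<Gamma> > 0"
  obtains r where "0 < r" "r < 1" "\<exists>\<^sub>F n in sequentially. 1 \<le> real (card (stake n ` \<Gamma>)) * r ^ n"
proof -
  obtain c where c: "0 < ereal c" "ereal c < entropy \<Gamma>"
    using ereal_dense2[OF assms] by blast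
  have "\<exists>\<^sub>F n in sequentially. c < ln (real (card (stake n ` \<Gamma>))) / real n"
  proof (rule ccontr)
    assume "\<not> ?thesis"
    then have "\<forall>\<^sub>F n in sequentially. ereal (ln (real (card (stake n ` \<Gamma>))) / real n) \<le> ereal c"
      by (simp add: not_frequently not_less)
    then have "entropy \<Gamma> \<le> ereal c"
      unfolding entropy_def by (rule Limsup_bounded)
    with c show False
      by simp
  qed
  then have "\<exists>\<^sub>F n in sequentially. 1 \<le> real (card (stake n ` \<Gamma>)) * exp (- c) ^ n"
  proof (rule frequently_elim1)
    fix n assume n: "c < ln (real (card (stake n ` \<Gamma>))) / real n"
    \<comment> \<open>At n = 0 the quotient is 0 by convention, which is not above c.\<close>
    have "n \<noteq> 0"
      using n c by (cases n) auto
    then have ln: "c * real n < ln (real (card (stake n ` \<Gamma>)))"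
      using n by (simp add: field_simps)
    moreover have "0 \<le> c * real n"
      using c by simp
    \<comment> \<open>The convention \<open>ln 0 = 0\<close> lets a positive logarithm exclude
      cardinality 0.\<close>
    ultimately have "0 < card (stake n ` \<Gamma>)"
      by (metis gr0I ln_0 of_nat_0 not_le)
    with ln have "exp (c * real n) \<le> real (card (stake n ` \<Gamma>))"
      by (simp add: ln_ge_iff[symmetric])
    then show "1 \<le> real (card (stake n ` \<Gamma>)) * exp (- c) ^ n"
      by (simp add: exp_of_nat_mult[symmetric] exp_minus field_simps)
  qed
  then show thesis
    using c by (intro that[of "exp (- c)"]) auto
qed

section \<open>Existence of a least zero\<close>

lemma card_hull_words_1_le: "card (hull_words \<alpha> \<beta> 1) \<le> 2"
proof -
  have "hull_words \<alpha> \<beta> 1 \<subseteq> {[False], [True]}"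
    by (auto simp: hull_words_def)
  then have "card (hull_words \<alpha> \<beta> 1) \<le> card {[False], [True]}"
    by (intro card_mono) auto
  then show ?thesis
    by simp
qed

lemma kneading_zero_exists:
  assumes adm: "admissible \<alpha> \<beta>" and "non_null \<alpha> \<beta>"
  shows "\<exists>x\<in>{1/2..<1}. (\<Sum>n. kneading_coeff \<alpha> \<beta> n * x ^ n) = 0"
proof -
  define a where "a n = real (card (hull_words \<alpha> \<beta> n))" for n
  define f where "f x = (\<Sum>n. kneading_coeff \<alpha> \<beta> n * x ^ n)" for x :: real
  have cont: "continuous_on {-1<..<1} f"
    unfolding f_def by (rule continuous_on_bounded_power_series) (rule abs_kneading_coeff_le)
  have a1: "1 \<le> a n" for n
    unfolding a_def by (rule card_hull_words_ge_1[OF adm])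
  have a0: "a 0 = 1"
    by (simp add: a_def card_hull_words[OF adm])
  have summable: "summable (\<lambda>n. a n * x ^ n)" if "0 \<le> x" "a m * x ^ m < 1" for x m
  proof (rule submultiplicative_summable[where m = m])
    show "0 < m"
      using that(2) a0 by (cases m) auto
    show "a (i + j) * x ^ (i + j) \<le> a i * x ^ i * (a j * x ^ j)" for i j
    proof -
      have "a (i + j) \<le> a i * a j"
        unfolding a_def using card_hull_words_submultiplicative[of \<alpha> \<beta> i j]
        by (metis of_nat_le_iff of_nat_mult)
      then have "a (i + j) * x ^ (i + j) \<le> a i * a j * x ^ (i + j)"
        using that by (intro mult_right_mono) auto
      then show ?thesis
        by (simp add: power_add mult_ac)
    qed
  qed (use that a_def in auto)
  obtain r where r: "0 < r" "r < 1"
    and freq: "\<exists>\<^sub>F n in sequentially. 1 \<le> real (card (stake n ` Omega_pair \<alpha> \<beta>)) * r ^ n"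
    using entropy_pos_frequently assms(2) unfolding non_null_def by blast
  have freq: "\<exists>\<^sub>F n in sequentially. 1 \<le> a n * r ^ n"
    using freq
  proof (rule frequently_elim1)
    fix n assume *: "1 \<le> real (card (stake n ` Omega_pair \<alpha> \<beta>)) * r ^ n"
    have "card (stake n ` Omega_pair \<alpha> \<beta>) \<le> card (hull_words \<alpha> \<beta> n)"
      using Omega_pair_subset_hull unfolding hull_words_def[symmetric]
      by (intro card_mono) (auto intro!: stake_in_hull_words)
    then have "real (card (stake n ` Omega_pair \<alpha> \<beta>)) * r ^ n \<le> a n * r ^ n"
      unfolding a_def using r by (intro mult_right_mono) auto
    with * show "1 \<le> a n * r ^ n"
      by simp
  qed
  \<comment> \<open>On D no term drops below 1, while outside D, within \<open>{0..r}\<close>, some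
    term does and the series converges by submultiplicativity. The infimum of D thus serves as the
    radius of convergence, and the cap r keeps it below 1.\<close>
  define D where "D = {x \<in> {0..r}. \<forall>n. 1 \<le> a n * x ^ n}"
  \<comment> \<open>Otherwise the series converges at r and its terms tend to 0, contradicting
    \<open>freq\<close>.\<close>
  have "r \<in> D"
  proof (rule ccontr)
    assume "r \<notin> D"
    then obtain m where "a m * r ^ m < 1"
      using r by (auto simp: D_def not_le)
    then have "(\<lambda>n. a n * r ^ n) \<longlonglongrightarrow> 0"
      using summable r by (intro summable_LIMSEQ_zero) auto
    then have "\<forall>\<^sub>F n in sequentially. a n * r ^ n < 1"
      by (rule order_tendstoD(2)) simp
    with freq show False
      by (simp add: frequently_def not_le)
  qed
  define R where "R = Inf D"
  have D_bdd: "bdd_below D"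
    by (auto simp: D_def)
  have "closed D"
  proof -
    have "D = {0..r} \<inter> (\<Inter>n. {x. 1 \<le> a n * x ^ n})"
      by (auto simp: D_def)
    moreover have "closed {x. 1 \<le> a n * x ^ n}" for n
      by (intro closed_Collect_le continuous_intros)
    ultimately show ?thesis
      by auto
  qed
  then have "R \<in> D"
    unfolding R_def using \<open>r \<in> D\<close> D_bdd by (intro closed_contains_Inf) auto
  then have R: "0 \<le> R" "R \<le> r" "\<And>n. 1 \<le> a n * R ^ n"
    by (auto simp: D_def)
  \<comment> \<open>There are at most two words of length 1, and the term of index 1 is at least 1
    at R.\<close>
  have "1/2 \<le> R"
  proof -
    have "1 \<le> a 1 * R"
      using R(3)[of 1] by simp
    also have "\<dots> \<le> 2 * R"
      using R(1) card_hull_words_1_le[of \<alpha> \<beta>] unfolding a_def by (intro mult_right_mono) auto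
    finally show ?thesis
      by simp
  qed
  \<comment> \<open>Otherwise the Cauchy product identity would bound \<open>\<Sum> (a\<^sub>n - 1) x\<^sup>n\<close>
    as \<open>x\<close> increases to \<open>R\<close>, although \<open>a\<^sub>n R\<^sup>n \<ge> 1\<close>.\<close>
  have fR: "f R \<le> 0"
  proof (rule ccontr)
    assume "\<not> f R \<le> 0"
    then have pos: "0 < f R"
      by simp
    have "isCont f R"
      using cont R r by (simp add: continuous_on_eq_continuous_at)
    \<comment> \<open>The limit is taken from the left because points below the infimum of D lie
      outside D, where the series converges.\<close>
    then have lim: "(f \<longlongrightarrow> f R) (at_left R)"
      unfolding isCont_def by (rule filterlim_mono) (auto simp: at_le)
    have "f R * (\<Sum>n<K. (a n - 1) * R ^ n) \<le> 1 / (1 - R)\<^sup>2" for K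
    proof (rule tendsto_le[OF trivial_limit_at_left_real])
      show "((\<lambda>x. 1 / (1 - x)\<^sup>2) \<longlongrightarrow> 1 / (1 - R)\<^sup>2) (at_left R)"
        using R r by (intro tendsto_intros) auto
      show "((\<lambda>x. f x * (\<Sum>n<K. (a n - 1) * x ^ n)) \<longlongrightarrow> f R * (\<Sum>n<K. (a n - 1) * R ^ n)) (at_left R)"
        by (intro tendsto_intros lim)
      have "\<forall>\<^sub>F x in at_left R. 0 < f x"
        using order_tendstoD(1)[OF lim pos] .
      moreover have "\<forall>\<^sub>F x in at_left R. x \<in> {0<..<R}"
        using \<open>1/2 \<le> R\<close> by (intro eventually_at_leftI[of 0]) auto
      ultimately show "\<forall>\<^sub>F x in at_left R. f x * (\<Sum>n<K. (a n - 1) * x ^ n) \<le> 1 / (1 - x)\<^sup>2"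
      proof eventually_elim
        case (elim x)
        have "x \<notin> D"
          using elim cInf_lower[OF _ D_bdd, of x] by (auto simp: R_def)
        then obtain m where "a m * x ^ m < 1"
          using elim R by (auto simp: D_def not_le)
        then have "summable (\<lambda>n. a n * x ^ n)"
          using elim by (intro summable) auto
        then show ?case
          using kneading_times_partial_sum_le[OF adm, of x K] elim R r
          by (simp add: a_def f_def)
      qed
    qed
    \<comment> \<open>Every \<open>a n * R ^ n\<close> is at least 1, so the partial sums grow
      without bound in K, against a bound independent of K.\<close>
    moreover have "real K - 1 / (1 - R) \<le> (\<Sum>n<K. (a n - 1) * R ^ n)" for K
    proof -
      have "(\<Sum>n<K. R ^ n) \<le> (\<Sum>n. R ^ n)"
        using R r by (intro sum_le_suminf summable_geometric) auto
      then have "(\<Sum>n<K. R ^ n) \<le> 1 / (1 - R)"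
        using R r by (simp add: suminf_geometric)
      moreover have "real K \<le> (\<Sum>n<K. a n * R ^ n)"
        using sum_mono[of "{..<K}" "\<lambda>n. 1" "\<lambda>n. a n * R ^ n"] R(3) by simp
      ultimately show ?thesis
        by (simp add: left_diff_distrib sum_subtractf)
    qed
    ultimately have "f R * (real K - 1 / (1 - R)) \<le> 1 / (1 - R)\<^sup>2" for K
      using pos by (meson mult_left_mono order_trans less_imp_le)
    then have "real K \<le> 1 / (1 - R)\<^sup>2 / f R + 1 / (1 - R)" for K
      unfolding diff_le_eq[symmetric] pos_le_divide_eq[OF pos] by (simp add: mult.commute)
    then show False
      using reals_Archimedean2 not_le by blast
  qed
  have "\<exists>x\<ge>1/2. x \<le> R \<and> f x = 0"
  proof (rule IVT2')
    show "0 \<le> f (1/2)"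
      unfolding f_def by (rule kneading_half_nonneg[OF adm])
    show "continuous_on {1/2..R} f"
      using cont R r by (auto elim!: continuous_on_subset)
  qed (use fR \<open>1/2 \<le> R\<close> in auto)
  then show ?thesis
    using R r unfolding f_def by (metis atLeastLessThan_iff le_less_trans)
qed

text \<open>A least element must be attained. The zeros up to a known zero z form a nonempty compact
  set, and its minimum is also below every zero beyond z. Cutting at z avoids the open end at
  1.\<close>

lemma base_inv_bounds:
  assumes adm: "admissible \<alpha> \<beta>" and "non_null \<alpha> \<beta>"
  shows "base_inv \<alpha> \<beta> \<in> {1/2..<1}"
proof -
  define f where "f x = (\<Sum>n. kneading_coeff \<alpha> \<beta> n * x ^ n)" for x :: real
  define Z where "Z = {x::real. x \<in> {1/2..<1} \<and>
     (\<Sum>n. of_bool (\<alpha> !! n) * x ^ n) = (\<Sum>n. of_bool (\<beta> !! n) * x ^ n)}"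
  have Z_iff: "x \<in> Z \<longleftrightarrow> x \<in> {1/2..<1} \<and> f x = 0" for x
    using suminf_kneading_coeff[of x \<alpha> \<beta>] by (auto simp: Z_def f_def)
  obtain z where z: "z \<in> Z"
    using kneading_zero_exists[OF assms] unfolding Z_iff f_def by blast
  have "compact ({1/2..z} \<inter> f -` {0})"
  proof -
    have "continuous_on {1/2..z} f"
      unfolding f_def using z
      by (intro continuous_on_subset[OF continuous_on_bounded_power_series] abs_kneading_coeff_le)
        (auto simp: Z_iff)
    then have "closed ({1/2..z} \<inter> f -` {0})"
      by (intro continuous_closed_preimage) auto
    then show ?thesis
      by (metis compact_Icc compact_Int_closed inf.idem inf_assoc)
  qed
  moreover have "{1/2..z} \<inter> f -` {0} \<noteq> {}"
    using z by (auto simp: Z_iff)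
  ultimately obtain b where b: "b \<in> {1/2..z} \<inter> f -` {0}" "\<forall>y\<in>{1/2..z} \<inter> f -` {0}. b \<le> y"
    using compact_attains_inf by blast
  have "b \<in> Z"
    using b(1) z by (auto simp: Z_iff)
  moreover have "b \<le> y" if "y \<in> Z" for y
    using b that by (cases "y \<le> z") (auto simp: Z_iff)
  ultimately have "base_inv \<alpha> \<beta> = b"
    unfolding base_inv_def Z_def by (intro Least_equality) auto
  with \<open>b \<in> Z\<close> show ?thesis
    by (simp add: Z_iff)
qed

section \<open>Tiles and follower sets\<close>

text \<open>The word u before the point may carry leading zeros, which decimals drop; hence it is
  only required to reduce to s.\<close>

definition follower_set :: "bool stream \<Rightarrow> bool stream \<Rightarrow> bool list \<Rightarrow> bool stream set" where
  "follower_set \<alpha> \<beta> s = {\<tau>. \<exists>u. dropWhile Not u = s \<and> u @- \<tau> \<in> Omega0_minus \<alpha> \<beta>}"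

lemma decimals_of_Omega0_iff:
  "(s, \<tau>) \<in> decimals_of (Omega0_minus \<alpha> \<beta>) \<longleftrightarrow> \<tau> \<in> follower_set \<alpha> \<beta> s"
proof
  assume "(s, \<tau>) \<in> decimals_of (Omega0_minus \<alpha> \<beta>)"
  then obtain k \<omega> where "s = dropWhile Not (stake k \<omega>)" "\<tau> = sdrop k \<omega>" "\<omega> \<in> Omega0_minus \<alpha> \<beta>"
    by (auto simp: decimals_of_def insert_point_def)
  then show "\<tau> \<in> follower_set \<alpha> \<beta> s"
    unfolding follower_set_def by (auto intro!: exI[of _ "stake k \<omega>"] simp: stake_sdrop)
next
  assume "\<tau> \<in> follower_set \<alpha> \<beta> s"
  then obtain u where u: "dropWhile Not u = s" "u @- \<tau> \<in> Omega0_minus \<alpha> \<beta>"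
    by (auto simp: follower_set_def)
  have "insert_point (length u) (u @- \<tau>) = (s, \<tau>)"
    using u by (simp add: insert_point_def stake_shift sdrop_shift)
  with u show "(s, \<tau>) \<in> decimals_of (Omega0_minus \<alpha> \<beta>)"
    unfolding decimals_of_def by (metis (mono_tags, lifting) mem_Collect_eq)
qed

lemma pretile_eq_image:
  "pretile \<alpha> \<beta> s = (\<lambda>\<tau>. decimal_value (base \<alpha> \<beta>) (s, \<tau>)) ` follower_set \<alpha> \<beta> s"
  unfolding pretile_def left_part_def
  by (auto simp: decimals_of_Omega0_iff[symmetric] image_iff)

lemma dropWhile_Not_follower: "\<tau> \<in> follower_set \<alpha> \<beta> s \<Longrightarrow> dropWhile Not s = s"
  by (auto simp: follower_set_def)

section \<open>Moving the point across one digit\<close>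

lemma Omega_minus_shift_iff:
  "u @- \<tau> \<in> Omega_minus \<alpha> \<beta> \<longleftrightarrow>
     (\<forall>n<length u. drop n u @- \<tau> \<notin> lex_Ioc \<alpha> \<beta>) \<and> \<tau> \<in> Omega_minus \<alpha> \<beta>"
proof -
  have "(\<forall>n. P n) \<longleftrightarrow> (\<forall>n<l. P n) \<and> (\<forall>n. P (l + n))" for P and l :: nat
    by (metis le_add_diff_inverse not_le)
  from this[of "\<lambda>n. sdrop n (u @- \<tau>) \<notin> lex_Ioc \<alpha> \<beta>" "length u"] show ?thesis
    by (simp add: Omega_minus_def sdrop_shift)
qed

text \<open>The condition that 0\<omega> is at most \<alpha> keeps 0\<omega> out of the gap, and it
  persists because 00\<omega> is below \<alpha>, which starts with 01.\<close>

lemma False_SCons_Omega0_minus: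
  assumes "admissible \<alpha> \<beta>" "\<omega> \<in> Omega0_minus \<alpha> \<beta>"
  shows "False ## \<omega> \<in> Omega0_minus \<alpha> \<beta>"
proof -
  have "[False] @- \<omega> \<in> Omega_minus \<alpha> \<beta>"
    unfolding Omega_minus_shift_iff using assms(2)
    by (auto simp: Omega0_minus_def lex_Ioc_def not_lex_less[symmetric])
  moreover have "lex_less (False ## False ## \<omega>) \<alpha>"
    using admissible_shd[OF assms(1)] by (subst lex_less_unfold, subst lex_less_unfold) simp
  ultimately show ?thesis
    by (simp add: Omega0_minus_def lex_le_def)
qed

text \<open>Prepending a zero makes the word nonempty, so there is a last digit to move across the
  point even when s is empty.\<close>

lemma follower_setE_snoc:
  assumes adm: "admissible \<alpha> \<beta>" and "\<tau> \<in> follower_set \<alpha> \<beta> s"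
  obtains u d where "dropWhile Not (u @ [d]) = s" "(u @ [d]) @- \<tau> \<in> Omega0_minus \<alpha> \<beta>"
proof -
  obtain u where u: "dropWhile Not u = s" "u @- \<tau> \<in> Omega0_minus \<alpha> \<beta>"
    using assms(2) by (auto simp: follower_set_def)
  have "dropWhile Not (False # u) = s" "(False # u) @- \<tau> \<in> Omega0_minus \<alpha> \<beta>"
    using u False_SCons_Omega0_minus[OF adm] by auto
  moreover have "False # u = butlast (False # u) @ [last (False # u)]"
    by (metis append_butlast_last_id list.distinct(1))
  ultimately show thesis
    using that by metis
qed

text \<open>A nonempty s starts with 1, which protects the digits after it. For empty s, a 1 in u
  would make the left side too long.\<close>

lemma dropWhile_Not_snoc_eqD:
  assumes "dropWhile Not (u @ [d]) = dropWhile Not (s @ [e])" "dropWhile Not s = s"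
  shows "d = e \<and> dropWhile Not u = s"
proof (cases "s = []")
  case True
  then show ?thesis
    using assms(1) by (cases "\<forall>x\<in>set u. \<not> x") (auto simp: dropWhile_append split: if_splits)
next
  case False
  then obtain t where t: "s = True # t"
    using assms(2) hd_dropWhile[of Not s] by (cases s) auto
  then have eq: "dropWhile Not (u @ [d]) = s @ [e]"
    using assms by simp
  show ?thesis
  proof (cases "\<forall>x\<in>set u. \<not> x")
    case True
    then have "dropWhile Not (u @ [d]) = dropWhile Not [d]"
      by (intro dropWhile_append2) auto
    with eq t show ?thesis
      by (auto split: if_splits)
  next
    case False
    then obtain x where "x \<in> set u" "x"
      by auto
    then have "dropWhile Not (u @ [d]) = dropWhile Not u @ [d]"
      by (intro dropWhile_append1) auto
    with eq show ?thesis
      by simp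
  qed
qed

text \<open>Moving the point leaves the underlying string unchanged. The outer
  \<open>dropWhile\<close> matters when s is empty and d is 0.\<close>

lemma follower_set_snoc:
  assumes adm: "admissible \<alpha> \<beta>" and s: "dropWhile Not s = s"
  shows "\<tau> \<in> follower_set \<alpha> \<beta> (dropWhile Not (s @ [d])) \<longleftrightarrow> d ## \<tau> \<in> follower_set \<alpha> \<beta> s"
proof
  assume "\<tau> \<in> follower_set \<alpha> \<beta> (dropWhile Not (s @ [d]))"
  then obtain u e where u: "dropWhile Not (u @ [e]) = dropWhile Not (s @ [d])"
      "(u @ [e]) @- \<tau> \<in> Omega0_minus \<alpha> \<beta>"
    by (rule follower_setE_snoc[OF adm])
  have "e = d \<and> dropWhile Not u = s"
    by (rule dropWhile_Not_snoc_eqD[OF u(1) s])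
  with u(2) show "d ## \<tau> \<in> follower_set \<alpha> \<beta> s"
    by (auto simp: follower_set_def)
next
  assume "d ## \<tau> \<in> follower_set \<alpha> \<beta> s"
  then obtain u where u: "dropWhile Not u = s" "u @- d ## \<tau> \<in> Omega0_minus \<alpha> \<beta>"
    by (auto simp: follower_set_def)
  have "dropWhile Not (u @ [d]) = dropWhile Not (dropWhile Not u @ [d])"
    by (induction u) auto
  with u show "\<tau> \<in> follower_set \<alpha> \<beta> (dropWhile Not (s @ [d]))"
    unfolding follower_set_def by (intro CollectI exI[of _ "u @ [d]"]) auto
qed

section \<open>Values of decimals and scaling of tiles\<close>

definition tail_value :: "real \<Rightarrow> bool stream \<Rightarrow> real" where
  "tail_value B \<tau> = (\<Sum>j. of_bool (\<tau> !! j) / B ^ (j + 1))"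

definition integer_part_value :: "real \<Rightarrow> bool list \<Rightarrow> real" where
  "integer_part_value B s = (\<Sum>i<length s. of_bool (s ! i) * B ^ (length s - 1 - i))"

lemma decimal_value_eq: "decimal_value B (s, \<tau>) = integer_part_value B s + tail_value B \<tau>"
  by (simp add: decimal_value_def tail_value_def integer_part_value_def)

lemma tail_value_eq:
  assumes "1 < B"
  shows "tail_value B \<tau> = (1 / B) * (\<Sum>j. of_bool (\<tau> !! j) * (1 / B) ^ j)"
proof -
  have "tail_value B \<tau> = (\<Sum>j. (1 / B) * (of_bool (\<tau> !! j) * (1 / B) ^ j))"
    unfolding tail_value_def by (simp add: power_one_over field_simps)
  also have "\<dots> = (1 / B) * (\<Sum>j. of_bool (\<tau> !! j) * (1 / B) ^ j)"
    using assms by (intro suminf_mult suminf_digits_bounds(1)) auto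
  finally show ?thesis .
qed

lemma tail_value_unfold:
  assumes "1 < B"
  shows "B * tail_value B (d ## \<tau>) = of_bool d + tail_value B \<tau>"
  using assms suminf_digits_unfold[of "1 / B" "d ## \<tau>"]
  by (simp add: tail_value_eq)

lemma integer_part_value_snoc:
  "integer_part_value B (s @ [d]) = B * integer_part_value B s + of_bool d"
proof -
  have "(\<Sum>i<length s. of_bool ((s @ [d]) ! i) * B ^ (length s - i)) =
      (\<Sum>i<length s. B * (of_bool (s ! i) * B ^ (length s - 1 - i)))"
  proof (rule sum.cong)
    fix i assume "i \<in> {..<length s}"
    then have "length s - i = Suc (length s - 1 - i)" "(s @ [d]) ! i = s ! i"
      by (auto simp: nth_append)
    then show "of_bool ((s @ [d]) ! i) * B ^ (length s - i) =
        B * (of_bool (s ! i) * B ^ (length s - 1 - i))"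
      by simp
  qed simp
  then show ?thesis
    by (simp add: integer_part_value_def sum_distrib_left del: sum_of_bool_mult_eq sum_mult_of_bool_eq)
qed

lemma integer_part_value_dropWhile:
  "integer_part_value B (dropWhile Not s) = integer_part_value B s"
proof (induction s rule: rev_induct)
  case (snoc d s)
  show ?case
  proof (cases "\<forall>x\<in>set s. \<not> x")
    case True
    then have "dropWhile Not s = []"
      by simp
    with snoc have "integer_part_value B s = 0"
      by (simp add: integer_part_value_def)
    moreover have "dropWhile Not (s @ [d]) = dropWhile Not [d]"
      using True by (intro dropWhile_append2) auto
    ultimately show ?thesis
      by (simp add: integer_part_value_snoc) (simp add: integer_part_value_def)
  next
    case False
    then obtain x where "x \<in> set s" "x"
      by auto
    then have "dropWhile Not (s @ [d]) = dropWhile Not s @ [d]"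
      by (intro dropWhile_append1) auto
    with snoc show ?thesis
      by (simp add: integer_part_value_snoc)
  qed
qed simp

lemma decimal_value_shift_point:
  assumes "1 < B"
  shows "B * decimal_value B (s, d ## \<tau>) = decimal_value B (dropWhile Not (s @ [d]), \<tau>)"
  by (simp add: decimal_value_eq integer_part_value_dropWhile integer_part_value_snoc
      distrib_left tail_value_unfold[OF assms])

text \<open>The tails that may follow s are sorted by their first digit d, which scaling moves to
  the left of the point.\<close>

lemma scaled_pretile:
  assumes adm: "admissible \<alpha> \<beta>" and B: "1 < base \<alpha> \<beta>" and s: "dropWhile Not s = s"
  shows "(*) (base \<alpha> \<beta>) ` pretile \<alpha> \<beta> s =
    (\<Union>d. pretile \<alpha> \<beta> (dropWhile Not (s @ [d])))"
proof -
  have "follower_set \<alpha> \<beta> s =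
      (\<Union>d. (##) d ` follower_set \<alpha> \<beta> (dropWhile Not (s @ [d])))" (is "_ = ?R")
  proof (intro equalityI subsetI)
    fix \<tau> assume \<tau>: "\<tau> \<in> follower_set \<alpha> \<beta> s"
    then have "stl \<tau> \<in> follower_set \<alpha> \<beta> (dropWhile Not (s @ [shd \<tau>]))"
      by (simp add: follower_set_snoc[OF adm s])
    then show "\<tau> \<in> ?R"
      by (intro UN_I[of "shd \<tau>"] image_eqI[of _ _ "stl \<tau>"]) auto
  qed (auto simp: follower_set_snoc[OF adm s])
  then show ?thesis
    by (simp add: pretile_eq_image image_UN image_image decimal_value_shift_point[OF B])
qed

lemma self_replicating_tiling:
  assumes adm: "admissible \<alpha> \<beta>" and B: "1 < base \<alpha> \<beta>"
  shows "self_replicating (base \<alpha> \<beta>) (tiling \<alpha> \<beta>)"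
  unfolding self_replicating_def
proof
  fix T assume "T \<in> tiling \<alpha> \<beta>"
  then obtain s where T: "T = tile \<alpha> \<beta> s" and "pretile \<alpha> \<beta> s \<noteq> {}"
    by (auto simp: tiling_def)
  then have s: "dropWhile Not s = s"
    unfolding pretile_eq_image using dropWhile_Not_follower by blast
  let ?t = "\<lambda>d. tile \<alpha> \<beta> (dropWhile Not (s @ [d]))"
  have "(\<lambda>x. base \<alpha> \<beta> * x) ` T = closure ((*) (base \<alpha> \<beta>) ` pretile \<alpha> \<beta> s)"
    using closure_scaleR[of "base \<alpha> \<beta>" "pretile \<alpha> \<beta> s"] by (simp add: T tile_def)
  also have "\<dots> = ?t False \<union> ?t True"
    unfolding scaled_pretile[OF adm B s] tile_def closure_Un[symmetric]
    by (simp add: UNIV_bool Un_commute)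
  \<comment> \<open>One of the two successors may be empty. It is not a tile, and leaving out its
    empty closure does not change the union.\<close>
  also have "\<dots> = \<Union>(?t ` {d. pretile \<alpha> \<beta> (dropWhile Not (s @ [d])) \<noteq> {}})" (is "?L = ?R")
  proof (intro equalityI subsetI)
    fix x assume "x \<in> ?L"
    then obtain d where "x \<in> ?t d"
      by blast
    then have "pretile \<alpha> \<beta> (dropWhile Not (s @ [d])) \<noteq> {}"
      by (auto simp: tile_def)
    with \<open>x \<in> ?t d\<close> show "x \<in> ?R"
      by blast
  next
    fix x assume "x \<in> ?R"
    then obtain d where "x \<in> ?t d"
      by blast
    then show "x \<in> ?L"
      by (cases d) auto
  qed
  finally show "\<exists>C\<subseteq>tiling \<alpha> \<beta>. (\<lambda>x. base \<alpha> \<beta> * x) ` T = \<Union>C"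
    by (intro exI conjI) (auto simp: tiling_def)
qed

section \<open>Finiteness of follower sets and tile lengths\<close>

text \<open>All the information about \<open>\<tau>\<close> on which the admissibility of \<open>u\<tau>\<close>, for any word \<open>u\<close>, depends.\<close>

definition tail_type ::
  "bool stream \<Rightarrow> bool stream \<Rightarrow> bool stream \<Rightarrow> bool \<times> bool stream set \<times> bool stream set" where
  "tail_type \<alpha> \<beta> \<tau> =
     (\<tau> \<in> Omega_minus \<alpha> \<beta>, {a \<in> range (\<lambda>n. sdrop n \<alpha>). lex_le \<tau> a},
      {c \<in> range (\<lambda>n. sdrop n \<beta>). lex_less c \<tau>})"

lemma Omega0_minus_shift_cong:
  assumes "tail_type \<alpha> \<beta> \<sigma> = tail_type \<alpha> \<beta> \<tau>"
  shows "v @- \<sigma> \<in> Omega0_minus \<alpha> \<beta> \<longleftrightarrow> v @- \<tau> \<in> Omega0_minus \<alpha> \<beta>"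
proof -
  have "lex_le \<sigma> (sdrop n \<alpha>) \<longleftrightarrow> lex_le \<tau> (sdrop n \<alpha>)"
      "lex_less (sdrop n \<beta>) \<sigma> \<longleftrightarrow> lex_less (sdrop n \<beta>) \<tau>" for n
    using assms by (auto simp: tail_type_def)
  then have le: "lex_le (u @- \<sigma>) \<alpha> \<longleftrightarrow> lex_le (u @- \<tau>) \<alpha>"
    and less: "lex_less \<beta> (u @- \<sigma>) \<longleftrightarrow> lex_less \<beta> (u @- \<tau>)" for u
    by (simp_all only: lex_le_shift_left lex_less_shift_right)
  \<comment> \<open>By totality, both bounds of the half-open interval are negations of the
    comparisons in \<open>le\<close> and \<open>less\<close>; this is why \<open>tail_type\<close>
    uses a weak comparison for \<alpha> and a strict one for \<beta>.\<close>
  then have "u @- \<sigma> \<in> lex_Ioc \<alpha> \<beta> \<longleftrightarrow> u @- \<tau> \<in> lex_Ioc \<alpha> \<beta>" for u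
    by (metis (mono_tags, lifting) lex_Ioc_def mem_Collect_eq not_lex_less)
  then show ?thesis
    \<comment> \<open>The extra 0 accounts for the condition on 0\<omega> in
      \<open>Omega0_minus\<close>.\<close>
    using le[of "False # v"] assms
    by (simp add: Omega0_minus_def Omega_minus_shift_iff tail_type_def)
qed

text \<open>Past the preperiod, every shift is the periodic string of a rotation of s.\<close>

lemma finite_orbit:
  assumes "eventually_periodic \<omega>"
  shows "finite (range (\<lambda>n. sdrop n \<omega>))"
proof -
  obtain m s where s: "s \<noteq> []" "sdrop m \<omega> = cycle s"
    using assms by (auto simp: eventually_periodic_def)
  have "sdrop n \<omega> \<in> (\<lambda>n. sdrop n \<omega>) ` {..m} \<union> (\<lambda>k. cycle (rotate k s)) ` {..<length s}" for n
  proof (cases "n \<le> m")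
    case False
    then have "sdrop n \<omega> = sdrop (n - m) (sdrop m \<omega>)"
      by simp
    also have "\<dots> = cycle (rotate ((n - m) mod length s) s)"
      using s by (simp add: sdrop_cycle)
    finally show ?thesis
      using s(1) by (intro UnI2) simp
  qed auto
  then have "range (\<lambda>n. sdrop n \<omega>) \<subseteq>
      (\<lambda>n. sdrop n \<omega>) ` {..m} \<union> (\<lambda>k. cycle (rotate k s)) ` {..<length s}"
    by blast
  then show ?thesis
    by (rule finite_subset) auto
qed

text \<open>Every follower set is a union of classes of equal \<open>tail_type\<close>, and finite
  orbits leave only finitely many classes.\<close>

lemma finite_follower_sets:
  assumes "eventually_periodic \<alpha>" "eventually_periodic \<beta>"
  shows "finite (range (follower_set \<alpha> \<beta>))"
proof -
  let ?t = "tail_type \<alpha> \<beta>"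
  have "range ?t \<subseteq> UNIV \<times> Pow (range (\<lambda>n. sdrop n \<alpha>)) \<times> Pow (range (\<lambda>n. sdrop n \<beta>))"
    by (auto simp: tail_type_def)
  then have "finite (range ?t)"
    by (rule finite_subset) (use finite_orbit assms in auto)
  moreover have "follower_set \<alpha> \<beta> s = ?t -` (?t ` follower_set \<alpha> \<beta> s)" for s
  proof (intro equalityI subsetI)
    fix \<sigma> assume "\<sigma> \<in> ?t -` (?t ` follower_set \<alpha> \<beta> s)"
    then obtain \<tau> where "?t \<sigma> = ?t \<tau>" "\<tau> \<in> follower_set \<alpha> \<beta> s"
      by auto
    then show "\<sigma> \<in> follower_set \<alpha> \<beta> s"
      unfolding follower_set_def using Omega0_minus_shift_cong by blast
  qed auto
  then have "range (follower_set \<alpha> \<beta>) \<subseteq> vimage ?t ` Pow (range ?t)"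
    by blast
  ultimately show ?thesis
    by (meson finite_Pow_iff finite_imageI finite_subset)
qed

text \<open>Translation commutes with closure and moves supremum and infimum alike; boundedness and
  nonemptiness give these two their usual meaning.\<close>

lemma interval_length_closure_translation:
  fixes S :: "real set"
  assumes "S \<noteq> {}" "bounded S"
  shows "interval_length (closure ((+) c ` S)) = interval_length (closure S)"
proof -
  let ?C = "closure S"
  have C: "?C \<noteq> {}" "bdd_above ?C" "bdd_below ?C"
    using assms bounded_closure[OF assms(2)]
    by (auto intro: bounded_imp_bdd_above bounded_imp_bdd_below)
  have "Sup ((+) c ` ?C) = c + Sup ?C"
  proof (rule cSup_eq_non_empty)
    fix y assume "\<And>x. x \<in> (+) c ` ?C \<Longrightarrow> x \<le> y"
    then have "x \<le> y - c" if "x \<in> ?C" for x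
      using that by (simp add: le_diff_eq add.commute)
    then have "Sup ?C \<le> y - c"
      using C by (intro cSup_least)
    then show "c + Sup ?C \<le> y"
      by simp
  qed (use C in \<open>auto intro: cSup_upper\<close>)
  moreover have "Inf ((+) c ` ?C) = c + Inf ?C"
  proof (rule cInf_eq_non_empty)
    fix y assume "\<And>x. x \<in> (+) c ` ?C \<Longrightarrow> y \<le> x"
    then have "y - c \<le> x" if "x \<in> ?C" for x
      using that by (simp add: diff_le_eq add.commute)
    then have "y - c \<le> Inf ?C"
      using C by (intro cInf_greatest)
    then show "y \<le> c + Inf ?C"
      by simp
  qed (use C in \<open>auto intro: cInf_lower\<close>)
  ultimately show ?thesis
    by (simp add: interval_length_def closure_translation)
qed

text \<open>A tile is the closed set of tail values of its follower set, translated by the value of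
  s. Its length is therefore a function of the follower set.\<close>

lemma finite_tile_lengths:
  assumes "1 < base \<alpha> \<beta>" "eventually_periodic \<alpha>" "eventually_periodic \<beta>"
  shows "finite (interval_length ` tiling \<alpha> \<beta>)"
proof -
  let ?B = "base \<alpha> \<beta>"
  have bounded: "bounded (tail_value ?B ` S)" for S
  proof -
    have "\<bar>tail_value ?B \<tau>\<bar> \<le> (1 / ?B) * (1 / (1 - 1 / ?B))" for \<tau>
    proof -
      have "(\<Sum>j. of_bool (\<tau> !! j) * (1 / ?B) ^ j) \<in> {0..1 / (1 - 1 / ?B)}"
        using assms(1) by (intro suminf_digits_bounds(2)) auto
      then show ?thesis
        unfolding tail_value_eq[OF assms(1)] abs_mult using assms(1) by (intro mult_mono) auto
    qed
    then show ?thesis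
      by (auto simp: bounded_iff)
  qed
  have "interval_length (tile \<alpha> \<beta> s) =
      interval_length (closure (tail_value ?B ` follower_set \<alpha> \<beta> s))"
    if "pretile \<alpha> \<beta> s \<noteq> {}" for s
  proof -
    have "tile \<alpha> \<beta> s =
        closure ((+) (integer_part_value ?B s) ` tail_value ?B ` follower_set \<alpha> \<beta> s)"
      by (simp add: tile_def pretile_eq_image image_image decimal_value_eq)
    then show ?thesis
      using that bounded by (simp add: interval_length_closure_translation pretile_eq_image)
  qed
  then have "interval_length ` tiling \<alpha> \<beta> \<subseteq>
      (\<lambda>F. interval_length (closure (tail_value ?B ` F))) ` range (follower_set \<alpha> \<beta>)"
    unfolding tiling_def by blast
  then show ?thesis
    by (rule finite_subset) (intro finite_imageI finite_follower_sets assms)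
qed

theorem mainTheorem6:
  fixes \<alpha> \<beta> :: "bool stream"
  assumes "admissible \<alpha> \<beta>" and "non_null \<alpha> \<beta>"
  shows "self_replicating (base \<alpha> \<beta>) (tiling \<alpha> \<beta>) \<and>
    (eventually_periodic \<alpha> \<and> eventually_periodic \<beta> \<longrightarrow>
       finite (interval_length ` tiling \<alpha> \<beta>))"
proof -
  have "1 < base \<alpha> \<beta>"
    using base_inv_bounds[OF assms] by (auto simp: base_def)
  then show ?thesis
    using self_replicating_tiling[OF assms(1)] finite_tile_lengths by blast
qed

end
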